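(* Let $\lambda\in(0,1]$, and for each integer $n\ge1$ let $d_{\mathrm{tv}}(n):=d_{\mathrm{tv}}\big(Z_n(\lambda),Z(\lambda)\big)$ be the total variation distance between $Z_n(\lambda)$ and $Z(\lambda)$. Then for every $n\ge 1$, $$d_{\mathrm{tv}}(n)=\frac{\lambda^{n+1}}{2\, n!}\int_0^1 \big[y^n+(2-y)^n\big] e^{-\lambda y}\,\mathrm{d}y.$$ Moreover, for every $n\ge1$, $$d_{\mathrm{tv}}(n)>\frac{2^{n}\lambda^{n+1}}{(n+1)!}\left(1-\frac{2\lambda}{n+2}\left(1-\frac{1}{2^{n+1}}\right)\right)$$ and $$d_{\mathrm{tv}}(n)<\frac{2^{n}\lambda^{n+1}}{(n+1)!}\left(1-\frac{2\lambda}{n+2}\left(1-\frac{1}{2^{n+1}}\right)+\frac{4\lambda^2}{(n+2)(n+3)}\left(1-\frac{n+3}{2^{n+2}}\right)\right).$$ Hence, as $n\to\infty$, $$d_{\mathrm{tv}}(n)\sim\frac{2^n\lambda^{n+1}}{(n+1)!}\quad\text{and, more precisely,}\quad d_{\mathrm{tv}}(n)=\frac{2^n\lambda^{n+1}}{(n+1)!}\left(1-\frac{2\lambda}{n+2}+o\left(\frac1n\right)\right).$$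
   Context: For $n\ge1$ and $\lambda\in(0,1]$, the random variable $Z_n(\lambda)$ (generalized matching distribution) is defined by $Z_n(\lambda)=\sum_{i=1}^n J_i\,\mathbf{1}\{\pi_n(i)=i\}$, where $\pi_n$ is a uniformly random permutation of $\{1,\ldots,n\}$ and $J_1,\ldots,J_n$ are i.i.d. Bernoulli($\lambda$) random variables independent of $\pi_n$; equivalently, its probability mass function is $$\mathbb{P}(Z_n(\lambda)=j)=\frac{\lambda^j}{j!}\sum_{i=0}^{n-j}\frac{(-\lambda)^i}{i!},\qquad j=0,1,\ldots,n.$$ $Z(\lambda)$ is a Poisson random variable with mean $\lambda$. The total variation distance is $d_{\mathrm{tv}}(X_1,X_2)=\sup_{A\in\mathcal{B}(\mathbb{R})}|\mathbb{P}(X_1\in A)-\mathbb{P}(X_2\in A)|$, where $\mathcal{B}(\mathbb{R})$ is the Borel $\sigma$-algebra of $\mathbb{R}$. $a_n\sim b_n$ means $\lim_{n\to\infty}a_n/b_n=1$. *)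

theory Defs
  imports "HOL-Probability.Probability" "HOL-Combinatorics.Permutations"
    "HOL-Library.Landau_Symbols"
begin

text \<open>
  Total variation distance between (the laws of) two real random variables, which may live on
  different probability spaces.
\<close>
definition dtv :: "'a measure \<Rightarrow> ('a \<Rightarrow> real) \<Rightarrow> 'b measure \<Rightarrow> ('b \<Rightarrow> real) \<Rightarrow> real" where
  "dtv M X N Y = (SUP A\<in>sets (borel :: real measure).
     \<bar>measure M {\<omega> \<in> space M. X \<omega> \<in> A} - measure N {\<omega> \<in> space N. Y \<omega> \<in> A}\<bar>)"

text \<open>
  Joint law of a uniform permutation of \<open>{1..n}\<close> and an independent family of \<open>n\<close> i.i.d.
  Bernoulli variables. The value \<open>False\<close> is the irrelevant default of the family outside \<open>{1..n}\<close>.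
\<close>
definition matching_space :: "nat \<Rightarrow> real \<Rightarrow> ((nat \<Rightarrow> nat) \<times> (nat \<Rightarrow> bool)) pmf" where
  "matching_space n lam =
     pair_pmf (pmf_of_set {p. p permutes {1..n}}) (Pi_pmf {1..n} False (\<lambda>_. bernoulli_pmf lam))"

definition matching_Z :: "nat \<Rightarrow> (nat \<Rightarrow> nat) \<times> (nat \<Rightarrow> bool) \<Rightarrow> real" where
  "matching_Z n = (\<lambda>(p, J). \<Sum>i=1..n. of_bool (J i) * of_bool (p i = i))"

end

theory Submission
  imports Defs "HOL-Real_Asymp.Real_Asymp"
begin

text \<open>
  The factorial moments of the number of marked fixed points agree with those of the Poisson law up
  to order \<open>n\<close>, and binomial inversion turns them into the mass function. The total variation
  distance is half the \<open>L\<^sup>1\<close> distance of the mass functions. On \<open>{0..n}\<close> their differences are Taylor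
  remainders of \<open>exp (- \<lambda>)\<close>, whose integral forms add up, by the binomial theorem, to the integral of
  \<open>(2 - y) ^ n * exp (- \<lambda> * y)\<close>; the Poisson tail beyond \<open>n\<close> is the remainder of \<open>exp \<lambda>\<close>, which
  contributes \<open>y ^ n * exp (- \<lambda> * y)\<close>. The bounds come from \<open>1 - u < exp (- u) < 1 - u + u\<^sup>2 / 2\<close>.
\<close>

section \<open>Total variation as half the \<open>L1\<close> distance of mass functions\<close>

lemma pmf_has_sum: "(pmf p has_sum measure_pmf.prob p A) A"
  by (metis abs_summable_equivalent abs_summable_summable has_sum_infsum infsetsum_infsum
      measure_pmf_conv_infsetsum pmf_abs_summable)

text \<open>Both laws have total mass one, so the difference \<open>?D\<close> changes sign under
  complement. Hence \<open>2 * ?D A\<close> is the sum of the pointwise differences with signs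
  flipped off \<open>A\<close>. The sum of absolute values dominates it, with equality when
  \<open>A\<close> is the set where \<open>p\<close> exceeds \<open>q\<close>.\<close>

lemma
  assumes "((\<lambda>x. \<bar>pmf p x - pmf q x\<bar>) has_sum s) UNIV"
  shows prob_diff_le_half_L1: "\<bar>measure_pmf.prob p B - measure_pmf.prob q B\<bar> \<le> s / 2"
    and prob_diff_eq_half_L1:
      "measure_pmf.prob p {x. pmf q x < pmf p x} - measure_pmf.prob q {x. pmf q x < pmf p x} = s / 2"
proof -
  let ?D = "\<lambda>A. measure_pmf.prob p A - measure_pmf.prob q A"
  have D: "((\<lambda>x. pmf p x - pmf q x) has_sum ?D A) A" for A
    using has_sum_add[OF pmf_has_sum[of p A] has_sum_uminusI[OF pmf_has_sum[of q A]]] by simp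
  have compl: "?D (- A) = - ?D A" for A
    using measure_pmf.prob_compl[of A p] measure_pmf.prob_compl[of A q] by (simp add: Compl_eq_Diff_UNIV)
  have signed: "((\<lambda>x. if x \<in> A then pmf p x - pmf q x else pmf q x - pmf p x) has_sum 2 * ?D A) UNIV" for A
  proof -
    have "((\<lambda>x. if x \<in> A then pmf p x - pmf q x else pmf q x - pmf p x) has_sum ?D A) A"
      using D[of A] by (rule has_sum_cong[THEN iffD1, rotated]) auto
    moreover have "((\<lambda>x. if x \<in> A then pmf p x - pmf q x else pmf q x - pmf p x) has_sum ?D A) (- A)"
      using has_sum_uminusI[OF D[of "- A"]] unfolding compl minus_minus minus_diff_eq
      by (rule has_sum_cong[THEN iffD1, rotated]) auto
    ultimately show ?thesis
      using has_sum_Un_disjoint by fastforce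
  qed
  have le: "?D A \<le> s / 2" for A
  proof -
    have "2 * ?D A \<le> s"
      by (rule has_sum_mono[OF signed[of A] assms]) auto
    then show ?thesis
      by simp
  qed
  show "\<bar>?D B\<bar> \<le> s / 2"
    using le[of B] le[of "- B"] compl[of B] by linarith
  have "((\<lambda>x. \<bar>pmf p x - pmf q x\<bar>) has_sum 2 * ?D {x. pmf q x < pmf p x}) UNIV"
    using signed by (rule has_sum_cong[THEN iffD1, rotated]) auto
  then show "?D {x. pmf q x < pmf p x} = s / 2"
    using assms has_sum_unique by fastforce
qed

text \<open>For integer-valued variables the supremum over Borel sets runs over preimages under
  \<open>real\<close>, and it is a maximum, attained where the first mass function exceeds the
  second.\<close>

lemma dtv_of_nat:
  assumes "((\<lambda>k. \<bar>pmf (map_pmf f M) k - pmf (map_pmf g N) k\<bar>) has_sum s) UNIV"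
  shows "dtv (measure_pmf M) (\<lambda>\<omega>. real (f \<omega>)) (measure_pmf N) (\<lambda>\<omega>. real (g \<omega>)) = s / 2"
proof -
  let ?D = "\<lambda>B. measure_pmf.prob (map_pmf f M) B - measure_pmf.prob (map_pmf g N) B"
  have pre: "{\<omega> \<in> space M. real (f \<omega>) \<in> A} = f -` real -` A" "{\<omega> \<in> space N. real (g \<omega>) \<in> A} = g -` real -` A" for A
    by auto
  have conv: "dtv (measure_pmf M) (\<lambda>\<omega>. real (f \<omega>)) (measure_pmf N) (\<lambda>\<omega>. real (g \<omega>))
    = (SUP A\<in>sets (borel :: real measure). \<bar>?D (real -` A)\<bar>)"
    unfolding dtv_def pre by simp
  let ?P = "{k. pmf (map_pmf g N) k < pmf (map_pmf f M) k}"
  \<comment> \<open>A set of naturals is a countable set of reals, hence Borel, so the optimal set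
    competes in the supremum.\<close>
  have "real ` ?P \<in> sets borel"
    by (rule sets.countable) auto
  moreover have "s / 2 = \<bar>?D (real -` real ` ?P)\<bar>"
    using prob_diff_eq_half_L1[OF assms] prob_diff_le_half_L1[OF assms, of ?P]
    unfolding inj_vimage_image_eq[OF inj_of_nat] by linarith
  ultimately have "s / 2 \<in> (\<lambda>A. \<bar>?D (real -` A)\<bar>) ` sets borel"
    by (rule rev_image_eqI)
  then show ?thesis
    unfolding conv by (rule cSup_eq_maximum) (use prob_diff_le_half_L1[OF assms] in auto)
qed

section \<open>The mass function of the number of marked fixed points\<close>

text \<open>The \<open>nat\<close>-valued form of \<open>matching_Z\<close>, so that binomial
  coefficients of it and a mass function on \<open>nat\<close> make sense.\<close>

definition fixed_count :: "nat \<Rightarrow> (nat \<Rightarrow> nat) \<times> (nat \<Rightarrow> bool) \<Rightarrow> nat" where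
  "fixed_count n = (\<lambda>(p, J). card {i \<in> {1..n}. J i \<and> p i = i})"

lemma matching_Z_eq: "matching_Z n = (\<lambda>\<omega>. real (fixed_count n \<omega>))"
  unfolding matching_Z_def fixed_count_def
  by (auto simp: fun_eq_iff Int_def simp flip: of_bool_conj intro!: arg_cong[where f = card])

text \<open>Permutations of \<open>A\<close> that fix \<open>S\<close> pointwise are exactly the
  permutations of \<open>A - S\<close>.\<close>

lemma card_permutes_fixing:
  assumes "finite A" "S \<subseteq> A"
  shows "card {p. p permutes A \<and> (\<forall>i\<in>S. p i = i)} = fact (card A - card S)"
proof -
  have "{p. p permutes A \<and> (\<forall>i\<in>S. p i = i)} = {p. p permutes (A - S)}"
    using assms(2) by (auto intro: permutes_superset permutes_subset permutes_not_in)
  then show ?thesis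
    using assms by (simp add: card_permutations card_Diff_subset finite_subset)
qed

lemma prob_matching_space_fixing:
  assumes lam: "0 \<le> lam" "lam \<le> 1" and S: "S \<subseteq> {1..n}"
  shows "measure_pmf.prob (matching_space n lam) {(p, J). \<forall>i\<in>S. J i \<and> p i = i}
    = lam ^ card S * fact (n - card S) / fact n"
proof -
  let ?P = "pmf_of_set {p. p permutes {1..n}}"
  let ?Q = "Pi_pmf {1..n} False (\<lambda>_. bernoulli_pmf lam)"
  let ?A = "{p. \<forall>i\<in>S. p i = i}" and ?B = "{J. \<forall>i\<in>S. J i}"
  have "measure_pmf.prob (matching_space n lam) {(p, J). \<forall>i\<in>S. J i \<and> p i = i}
      = measure_pmf.prob (pair_pmf ?P ?Q) ((?A \<inter> set_pmf ?P) \<times> (?B \<inter> set_pmf ?Q))"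
    unfolding matching_space_def
    by (subst measure_Int_set_pmf[symmetric]) (auto intro!: arg_cong[where f = "measure _"])
  also have "\<dots> = measure_pmf.prob ?P ?A * measure_pmf.prob ?Q ?B"
    by (subst measure_pmf_prob_product) (auto simp: measure_Int_set_pmf)
  also have "measure_pmf.prob ?P ?A = fact (n - card S) / fact n"
  proof -
    have "{p. p permutes {1..n}} \<noteq> {}"
      using permutes_id by blast
    then show ?thesis
      using card_permutes_fixing[OF _ S]
      by (simp add: measure_pmf_of_set finite_permutations card_permutations Collect_conj_eq)
  qed
  also have "measure_pmf.prob ?Q ?B = lam ^ card S"
  proof -
    have "?B = Pi {1..n} (\<lambda>i. if i \<in> S then {True} else UNIV)"
      using S by (auto simp: Pi_def)
    then have "measure_pmf.prob ?Q ?B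
        = (\<Prod>i\<in>{1..n}. measure_pmf.prob (bernoulli_pmf lam) (if i \<in> S then {True} else UNIV))"
      by (simp only: measure_Pi_pmf_Pi finite_atLeastAtMost)
    also have "\<dots> = (\<Prod>i\<in>{1..n}. if i \<in> S then lam else 1)"
      using lam by (intro prod.cong) (auto simp: measure_pmf_single)
    also have "\<dots> = lam ^ card S"
      using S by (simp add: prod.If_cases Int_absorb1)
    finally show ?thesis .
  qed
  finally show ?thesis
    by simp
qed

text \<open>The binomial coefficient counts the \<open>k\<close>-subsets consisting of marked fixed
  points. By linearity the expectation is a sum over all \<open>k\<close>-subsets of
  \<open>{1..n}\<close>, each contributing the same probability.\<close>

lemma expectation_choose_fixed_count:
  assumes lam: "0 \<le> lam" "lam \<le> 1" and k: "k \<le> n"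
  shows "measure_pmf.expectation (matching_space n lam) (\<lambda>\<omega>. real (fixed_count n \<omega> choose k)) = lam ^ k / fact k"
proof -
  let ?\<S> = "{S. S \<subseteq> {1..n} \<and> card S = k}"
  let ?E = "\<lambda>S. {(p, J). \<forall>i\<in>S. J i \<and> p i = i} :: ((nat \<Rightarrow> nat) \<times> (nat \<Rightarrow> bool)) set"
  have "real (fixed_count n \<omega> choose k) = (\<Sum>S\<in>?\<S>. indicator (?E S) \<omega>)" for \<omega>
  proof -
    obtain p J where \<omega>: "\<omega> = (p, J)"
      by fastforce
    let ?T = "{i \<in> {1..n}. J i \<and> p i = i}"
    have "fixed_count n \<omega> choose k = card {S. S \<subseteq> ?T \<and> card S = k}"
      unfolding \<omega> fixed_count_def prod.case by (rule n_subsets[symmetric]) simp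
    also have "{S. S \<subseteq> ?T \<and> card S = k} = {S \<in> ?\<S>. \<omega> \<in> ?E S}"
      unfolding \<omega> by auto
    finally show ?thesis
      by (simp add: indicator_def flip: of_bool_def)
        (simp add: Int_def)
  qed
  then have "measure_pmf.expectation (matching_space n lam) (\<lambda>\<omega>. real (fixed_count n \<omega> choose k))
      = (\<Sum>S\<in>?\<S>. measure_pmf.prob (matching_space n lam) (?E S))"
    by (simp only:) (subst Bochner_Integration.integral_sum,
        auto intro!: measure_pmf.integrable_const_bound[where B = 1])
  also have "\<dots> = (\<Sum>S\<in>?\<S>. lam ^ k * fact (n - k) / fact n)"
    using prob_matching_space_fixing[OF lam] by (intro sum.cong) auto
  also have "\<dots> = lam ^ k / fact k"
    using k by (simp add: n_subsets binomial_fact field_simps)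
  finally show ?thesis .
qed

text \<open>Rewriting the product of binomials as \<open>(z choose j) * ((z - j) choose i)\<close>
  leaves an alternating row sum, which vanishes unless \<open>z = j\<close>.\<close>

lemma binomial_inversion_indicator:
  assumes "z \<le> n"
  shows "(\<Sum>i\<le>n - j. (-1) ^ i * real ((i + j) choose j) * real (z choose (i + j))) = of_bool (z = j)"
proof (cases "j \<le> z")
  case True
  \<comment> \<open>Terms with \<open>i > z - j\<close> vanish; \<open>z \<le> n\<close> ensures
    that the shorter range lies inside the original one.\<close>
  have "(\<Sum>i\<le>n - j. (-1) ^ i * real ((i + j) choose j) * real (z choose (i + j)))
      = (\<Sum>i\<le>z - j. (-1) ^ i * real ((i + j) choose j) * real (z choose (i + j)))"
    using assms True by (intro sum.mono_neutral_right) auto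
  also have "\<dots> = (\<Sum>i\<le>z - j. real (z choose j) * ((-1) ^ i * real ((z - j) choose i)))"
  proof (intro sum.cong refl)
    fix i assume "i \<in> {..z - j}"
    then have "(z choose (i + j)) * ((i + j) choose j) = (z choose j) * ((z - j) choose i)"
      using choose_mult[of j "i + j" z] True by simp
    then show "(-1) ^ i * real ((i + j) choose j) * real (z choose (i + j))
        = real (z choose j) * ((-1) ^ i * real ((z - j) choose i))"
      by (metis (no_types, lifting) mult.assoc mult.commute of_nat_mult)
  qed
  also have "\<dots> = real (z choose j) * (\<Sum>i\<le>z - j. (-1) ^ i * real ((z - j) choose i))"
    by (simp add: sum_distrib_left)
  also have "\<dots> = of_bool (z = j)"
    using True choose_alternating_sum[of "z - j", where 'a = real] by (cases "z = j") auto
  finally show ?thesis .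
qed (auto intro!: sum.neutral)

lemma fixed_count_le: "fixed_count n \<omega> \<le> n"
proof (cases \<omega>)
  case (Pair p J)
  have "card {i \<in> {1..n}. J i \<and> p i = i} \<le> card {1..n}"
    by (rule card_mono) auto
  then show ?thesis
    by (simp add: Pair fixed_count_def)
qed

lemma pmf_fixed_count:
  assumes lam: "0 \<le> lam" "lam \<le> 1"
  shows "pmf (map_pmf (fixed_count n) (matching_space n lam)) j =
    (if j \<le> n then lam ^ j / fact j * (\<Sum>i\<le>n - j. (- lam) ^ i / fact i) else 0)"
proof (cases "j \<le> n")
  case False
  then have "fixed_count n -` {j} = {}"
    using fixed_count_le[of n] by auto
  with False show ?thesis
    by (simp add: pmf_map)
next
  case True
  let ?M = "matching_space n lam"
  have int: "integrable ?M (\<lambda>\<omega>. real (fixed_count n \<omega> choose k))" for k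
  proof (rule measure_pmf.integrable_const_bound)
    show "AE \<omega> in ?M. norm (real (fixed_count n \<omega> choose k)) \<le> real (n choose k)"
      using binomial_right_mono[OF fixed_count_le] by auto
  qed simp
  have "pmf (map_pmf (fixed_count n) ?M) j = measure_pmf.expectation ?M (indicator (fixed_count n -` {j}))"
    by (simp add: pmf_map)
  \<comment> \<open>Binomial inversion holds pointwise because the count never exceeds
    \<open>n\<close>. All orders \<open>i + j\<close> that occur are at most \<open>n\<close>, the
    range in which the factorial moments are known.\<close>
  also have "indicator (fixed_count n -` {j}) = (\<lambda>\<omega>. \<Sum>i\<le>n - j. (-1) ^ i * real ((i + j) choose j) * real (fixed_count n \<omega> choose (i + j)))"
    by (auto simp: fun_eq_iff binomial_inversion_indicator[OF fixed_count_le] indicator_def)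
  also have "measure_pmf.expectation ?M \<dots> =
      (\<Sum>i\<le>n - j. (-1) ^ i * real ((i + j) choose j) * (lam ^ (i + j) / fact (i + j)))"
    using True int by (simp add: expectation_choose_fixed_count[OF lam])
  also have "\<dots> = (\<Sum>i\<le>n - j. lam ^ j / fact j * ((- lam) ^ i / fact i))"
    by (intro sum.cong refl) (simp add: binomial_fact power_add power_minus[of lam])
  also have "\<dots> = lam ^ j / fact j * (\<Sum>i\<le>n - j. (- lam) ^ i / fact i)"
    by (simp add: sum_distrib_left)
  finally show ?thesis
    using True by simp
qed

section \<open>Taylor remainders of the exponential as integrals\<close>

text \<open>Integration by parts raises \<open>m\<close> by one. The remainder integral is rescaled
  to \<open>{0..1}\<close>, so that remainders of different orders can be added under one
  integral.\<close>

lemma exp_taylor_integral: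
  fixes x :: real
  shows "exp x = (\<Sum>i\<le>m. x ^ i / fact i) + x ^ Suc m / fact m * integral {0..1} (\<lambda>t. (1 - t) ^ m * exp (x * t))"
proof (induction m)
  case 0
  have "((\<lambda>t. x * exp (x * t)) has_integral exp (x * 1) - exp (x * 0)) {0..1}"
    by (rule fundamental_theorem_of_calculus)
      (auto intro!: derivative_eq_intros simp flip: has_real_derivative_iff_has_vector_derivative)
  then have "integral {0..1} (\<lambda>t. x * exp (x * t)) = exp x - 1"
    by (subst integral_unique) auto
  then show ?case
    by simp
next
  case (Suc m)
  let ?I = "\<lambda>m. integral {0..1} (\<lambda>t. (1 - t) ^ m * exp (x * t))"
  \<comment> \<open>The integrand is the derivative of \<open>(1 - t) ^ Suc m * exp (x * t)\<close>,
    whose increment over the interval is \<open>-1\<close>.\<close>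
  have "((\<lambda>t. x * ((1 - t) ^ Suc m * exp (x * t)) - real (Suc m) * ((1 - t) ^ m * exp (x * t)))
      has_integral (1 - 1) ^ Suc m * exp (x * 1) - (1 - 0) ^ Suc m * exp (x * 0)) {0..1}"
    by (rule fundamental_theorem_of_calculus)
      (auto intro!: derivative_eq_intros simp: algebra_simps simp del: power_Suc
        simp flip: has_real_derivative_iff_has_vector_derivative)
  then have "integral {0..1} (\<lambda>t. x * ((1 - t) ^ Suc m * exp (x * t)) - real (Suc m) * ((1 - t) ^ m * exp (x * t))) = -1"
    by (simp add: integral_unique)
  also have "integral {0..1} (\<lambda>t. x * ((1 - t) ^ Suc m * exp (x * t)) - real (Suc m) * ((1 - t) ^ m * exp (x * t)))
     = x * ?I (Suc m) - real (Suc m) * ?I m"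
    by (subst integral_diff) (auto intro!: integrable_continuous_real continuous_intros simp del: power_Suc of_nat_Suc)
  finally have step: "real (Suc m) * ?I m = 1 + x * ?I (Suc m)"
    by linarith
  have "x ^ Suc m / fact m * ?I m = x ^ Suc m / fact (Suc m) * (real (Suc m) * ?I m)"
    by (simp del: of_nat_Suc)
  then have "x ^ Suc m / fact m * ?I m = x ^ Suc m / fact (Suc m) * (1 + x * ?I (Suc m))"
    unfolding step .
  then show ?case
    using Suc by (simp add: algebra_simps)
qed

lemma integral_reflect_unit:
  fixes f :: "real \<Rightarrow> real"
  assumes "f integrable_on {0..1}"
  shows "integral {0..1} (\<lambda>t. f (1 - t)) = integral {0..1} f"
proof -
  have "(f has_integral integral {0..1} f) (cbox 0 1)"
    using assms by (simp add: integrable_integral)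
  from has_integral_affinity[OF this, of "-1" 1]
  have "((\<lambda>t. f (1 - t)) has_integral integral {0..1} f) ((\<lambda>x. 1 - x) ` {0..1})"
    by (simp add: add.commute)
  moreover have "(\<lambda>x::real. 1 - x) ` {0..1} = {0..1}"
    using image_affinity_atLeastAtMost[of "-1" 1 0 "1::real"] by simp
  ultimately show ?thesis
    by (simp add: integral_unique)
qed

text \<open>Absorbing \<open>exp (- x)\<close> into the Taylor remainder turns
  \<open>exp (x * t)\<close> into \<open>exp (- x * (1 - t))\<close>; the reflection
  \<open>y = 1 - t\<close> gives the stated integral.\<close>

lemma poisson_tail_integral:
  fixes x :: real
  shows "exp (- x) * (exp x - (\<Sum>i\<le>m. x ^ i / fact i))
    = x ^ Suc m / fact m * integral {0..1} (\<lambda>y. y ^ m * exp (- x * y))"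
proof -
  have "exp (- x) * integral {0..1} (\<lambda>t. (1 - t) ^ m * exp (x * t))
      = integral {0..1} (\<lambda>t. (1 - t) ^ m * exp (- x * (1 - t)))"
    unfolding integral_mult_right[symmetric]
    by (intro integral_cong) (simp add: algebra_simps exp_diff exp_minus field_simps)
  also have "\<dots> = integral {0..1} (\<lambda>y. y ^ m * exp (- x * y))"
    by (rule integral_reflect_unit[of "\<lambda>y. y ^ m * exp (- x * y)"])
      (intro integrable_continuous_real continuous_intros)
  finally show ?thesis
    using exp_taylor_integral[of x m] by (simp add: algebra_simps)
qed

text \<open>The terms of the sum are the absolute differences of the two mass functions on \<open>{0..n}\<close>.\<close>
lemma sum_abs_exp_remainder:
  fixes x :: real
  assumes "0 \<le> x"
  shows "(\<Sum>k\<le>n. \<bar>x ^ k / fact k * (\<Sum>i\<le>n - k. (- x) ^ i / fact i) - x ^ k / fact k * exp (- x)\<bar>)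
    = x ^ Suc n / fact n * integral {0..1} (\<lambda>y. (2 - y) ^ n * exp (- x * y))"
proof -
  let ?I = "\<lambda>m. integral {0..1} (\<lambda>t. (1 - t) ^ m * exp (- x * t))"
  have I: "0 \<le> ?I m" for m
    by (intro integral_nonneg integrable_continuous_real continuous_intros) auto
  have "\<bar>x ^ k / fact k * (\<Sum>i\<le>n - k. (- x) ^ i / fact i) - x ^ k / fact k * exp (- x)\<bar>
      = x ^ Suc n / fact n * (real (n choose k) * ?I (n - k))" if "k \<le> n" for k
  proof -
    have "x ^ k / fact k * (\<Sum>i\<le>n - k. (- x) ^ i / fact i) - x ^ k / fact k * exp (- x)
        = x ^ k / fact k * ((\<Sum>i\<le>n - k. (- x) ^ i / fact i) - exp (- x))"
      by (simp only: right_diff_distrib)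
    also have "\<dots> = x ^ k / fact k * - ((- x) ^ Suc (n - k) / fact (n - k) * ?I (n - k))"
      using exp_taylor_integral[of "- x" "n - k"] by simp
    also have "\<bar>\<dots>\<bar> = x ^ k / fact k * (x ^ Suc (n - k) / fact (n - k) * ?I (n - k))"
      using assms I[of "n - k"] by (simp add: abs_mult power_abs)
    also have "\<dots> = x ^ (k + Suc (n - k)) / (fact k * fact (n - k)) * ?I (n - k)"
      by (simp add: power_add)
    \<comment> \<open>The exponents of \<open>x\<close> add up to \<open>Suc n\<close> for every
      \<open>k\<close>, so the prefactor is common and only a binomial weight depends on
      \<open>k\<close>.\<close>
    also have "\<dots> = x ^ Suc n / fact n * (real (n choose k) * ?I (n - k))"
      using that by (simp add: binomial_fact)
    finally show ?thesis .
  qed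
  then have "(\<Sum>k\<le>n. \<bar>x ^ k / fact k * (\<Sum>i\<le>n - k. (- x) ^ i / fact i) - x ^ k / fact k * exp (- x)\<bar>)
      = x ^ Suc n / fact n * (\<Sum>k\<le>n. real (n choose k) * ?I (n - k))"
    by (simp add: sum_distrib_left)
  also have "(\<Sum>k\<le>n. real (n choose k) * ?I (n - k))
      = integral {0..1} (\<lambda>t. \<Sum>k\<le>n. real (n choose k) * ((1 - t) ^ (n - k) * exp (- x * t)))"
    by (subst integral_sum) (auto intro!: integrable_continuous_real continuous_intros)
  also have "\<dots> = integral {0..1} (\<lambda>t. (2 - t) ^ n * exp (- x * t))"
  proof (intro integral_cong)
    fix t :: real
    \<comment> \<open>Binomial theorem for \<open>2 - t = 1 + (1 - t)\<close>.\<close>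
    have "(2 - t) ^ n = (\<Sum>k\<le>n. real (n choose k) * (1 - t) ^ (n - k))"
      using binomial_ring[of 1 "1 - t" n] by simp
    then show "(\<Sum>k\<le>n. real (n choose k) * ((1 - t) ^ (n - k) * exp (- x * t))) = (2 - t) ^ n * exp (- x * t)"
      by (simp add: sum_distrib_right mult.assoc)
  qed
  finally show ?thesis .
qed

section \<open>Two-sided bounds for the integral\<close>

lemma exp_minus_bounds:
  fixes u :: real
  assumes "0 < u"
  shows "1 - u < exp (- u)" "exp (- u) < 1 - u + u\<^sup>2 / 2"
proof -
  show "1 - u < exp (- u)"
    using exp_minus_greater[of u] assms by simp
  \<comment> \<open>The third-order remainder carries the factor \<open>(- u) ^ 3\<close>, which is
    negative, so dropping it gives a strict upper bound.\<close>
  obtain t where "exp (- u) = (\<Sum>m<3. (- u) ^ m / fact m) + exp t / fact 3 * (- u) ^ 3"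
    using Maclaurin_exp_lt[of "- u" 3] assms by auto
  then show "exp (- u) < 1 - u + u\<^sup>2 / 2"
    using assms by (simp add: eval_nat_numeral mult_pos_pos)
qed

lemma has_integral_power_moments:
  fixes n :: nat
  shows "((\<lambda>y::real. y ^ n + (2 - y) ^ n) has_integral 2 ^ Suc n / (real n + 1)) {0..1}"
    and "((\<lambda>y::real. (y ^ n + (2 - y) ^ n) * y) has_integral
      2 ^ Suc n / (real n + 1) * (2 / (real n + 2) * (1 - 1 / 2 ^ Suc n))) {0..1}"
    and "((\<lambda>y::real. (y ^ n + (2 - y) ^ n) * y\<^sup>2) has_integral
      2 ^ Suc n / (real n + 1) * (8 / ((real n + 2) * (real n + 3)) * (1 - (real n + 3) / 2 ^ (n + 2)))) {0..1}"
proof -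
  have A: "((\<lambda>y::real. y ^ k) has_integral 1 / (real k + 1)) {0..1}" for k
  proof -
    have "((\<lambda>y::real. y ^ k) has_integral 1 ^ Suc k / real (Suc k) - 0 ^ Suc k / real (Suc k)) {0..1}"
      by (rule fundamental_theorem_of_calculus)
        (auto intro!: derivative_eq_intros simp del: power_Suc of_nat_Suc
          simp flip: has_real_derivative_iff_has_vector_derivative)
    then show ?thesis
      by (simp add: add.commute)
  qed
  have B: "((\<lambda>y::real. (2 - y) ^ k) has_integral (2 ^ Suc k - 1) / (real k + 1)) {0..1}" for k
  proof -
    have "((\<lambda>y::real. (2 - y) ^ k) has_integral
        - ((2 - 1) ^ Suc k / real (Suc k)) - - ((2 - 0) ^ Suc k / real (Suc k))) {0..1}"
      by (rule fundamental_theorem_of_calculus)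
        (auto intro!: derivative_eq_intros simp del: power_Suc of_nat_Suc
          simp flip: has_real_derivative_iff_has_vector_derivative)
    then show ?thesis
      by (simp add: diff_divide_distrib add.commute)
  qed
  show "((\<lambda>y::real. y ^ n + (2 - y) ^ n) has_integral 2 ^ Suc n / (real n + 1)) {0..1}"
    using has_integral_add[OF A[of n] B[of n]] by (simp add: diff_divide_distrib)
  \<comment> \<open>Writing \<open>y = 2 - (2 - y)\<close> reduces the first moment to pure powers
    of \<open>y\<close> and \<open>2 - y\<close>; the second moment below uses the square of this
    identity.\<close>
  have "((\<lambda>y::real. y ^ Suc n + (2 * (2 - y) ^ n - (2 - y) ^ Suc n)) has_integral
      1 / (real (Suc n) + 1) + (2 * ((2 ^ Suc n - 1) / (real n + 1)) - (2 ^ Suc (Suc n) - 1) / (real (Suc n) + 1))) {0..1}"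
    by (intro has_integral_add has_integral_diff has_integral_mult_right A B)
  also have "(\<lambda>y::real. y ^ Suc n + (2 * (2 - y) ^ n - (2 - y) ^ Suc n)) = (\<lambda>y. (y ^ n + (2 - y) ^ n) * y)"
    by (simp add: fun_eq_iff algebra_simps)
  also have "1 / (real (Suc n) + 1) + (2 * ((2 ^ Suc n - 1) / (real n + 1)) - (2 ^ Suc (Suc n) - 1) / (real (Suc n) + 1))
      = 2 ^ Suc n / (real n + 1) * (2 / (real n + 2) * (1 - 1 / 2 ^ Suc n))"
    by (simp add: divide_simps) (simp add: algebra_simps)
  finally show "((\<lambda>y::real. (y ^ n + (2 - y) ^ n) * y) has_integral
      2 ^ Suc n / (real n + 1) * (2 / (real n + 2) * (1 - 1 / 2 ^ Suc n))) {0..1}" .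
  have "((\<lambda>y::real. y ^ (n + 2) + (4 * (2 - y) ^ n - 4 * (2 - y) ^ Suc n + (2 - y) ^ (n + 2))) has_integral
      1 / (real (n + 2) + 1) + (4 * ((2 ^ Suc n - 1) / (real n + 1)) - 4 * ((2 ^ Suc (Suc n) - 1) / (real (Suc n) + 1))
        + (2 ^ Suc (n + 2) - 1) / (real (n + 2) + 1))) {0..1}"
    by (intro has_integral_add has_integral_diff has_integral_mult_right A B)
  also have "(\<lambda>y::real. y ^ (n + 2) + (4 * (2 - y) ^ n - 4 * (2 - y) ^ Suc n + (2 - y) ^ (n + 2)))
      = (\<lambda>y. (y ^ n + (2 - y) ^ n) * y\<^sup>2)"
    by (simp add: fun_eq_iff algebra_simps power2_eq_square)
  also have "1 / (real (n + 2) + 1) + (4 * ((2 ^ Suc n - 1) / (real n + 1)) - 4 * ((2 ^ Suc (Suc n) - 1) / (real (Suc n) + 1))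
        + (2 ^ Suc (n + 2) - 1) / (real (n + 2) + 1))
      = 2 ^ Suc n / (real n + 1) * (8 / ((real n + 2) * (real n + 3)) * (1 - (real n + 3) / 2 ^ (n + 2)))"
    by (simp add: divide_simps) (simp add: algebra_simps)
  finally show "((\<lambda>y::real. (y ^ n + (2 - y) ^ n) * y\<^sup>2) has_integral
      2 ^ Suc n / (real n + 1) * (8 / ((real n + 2) * (real n + 3)) * (1 - (real n + 3) / 2 ^ (n + 2)))) {0..1}" .
qed

text \<open>The bounds on \<open>exp (- x * y)\<close> are integrated against the weight
  \<open>?w\<close>, which is positive on the open interval, so strictness survives; the moments
  then evaluate the polynomial integrals.\<close>

lemma
  fixes x :: real
  assumes "0 < x"
  shows integral_power_exp_lower: "2 ^ Suc n / (real n + 1) * (1 - 2 * x / (real n + 2) * (1 - 1 / 2 ^ Suc n))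
      < integral {0..1} (\<lambda>y. (y ^ n + (2 - y) ^ n) * exp (- x * y))" (is "?L < ?I")
    and integral_power_exp_upper: "integral {0..1} (\<lambda>y. (y ^ n + (2 - y) ^ n) * exp (- x * y))
      < 2 ^ Suc n / (real n + 1) * (1 - 2 * x / (real n + 2) * (1 - 1 / 2 ^ Suc n)
        + 4 * x\<^sup>2 / ((real n + 2) * (real n + 3)) * (1 - (real n + 3) / 2 ^ (n + 2)))" (is "_ < ?U")
proof -
  let ?w = "\<lambda>y::real. y ^ n + (2 - y) ^ n"
  note m = has_integral_power_moments[of n]
  \<comment> \<open>Matches the combined moments to the stated bounds; the \<open>4\<close> in the
    quadratic term is half of the \<open>8\<close> in the second moment.\<close>
  have alg: "a * (1 - 2 * x / d * c) = a - x * (a * (2 / d * c))"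
    "a * (1 - 2 * x / d * c + 4 * x\<^sup>2 / e * f) = a - x * (a * (2 / d * c)) + x\<^sup>2 / 2 * (a * (8 / e * f))"
    for a c d e f :: real
    by (simp_all add: algebra_simps)
  have pos: "0 < ?w y" if "y \<in> {0<..<1}" for y
    using that by (intro add_pos_pos) auto
  have "((\<lambda>y. ?w y - x * (?w y * y)) has_integral ?L) {0..1}"
    using has_integral_diff[OF m(1) has_integral_mult_right[OF m(2), of x]]
    by (rule has_integral_eq_rhs) (rule alg(1))
  moreover have "integral {0..1} (\<lambda>y. ?w y - x * (?w y * y)) < ?I"
  proof (rule integral_less_real)
    fix y :: real assume y: "y \<in> {0<..<1}"
    have "?w y * (1 - x * y) < ?w y * exp (- x * y)"
      using exp_minus_bounds(1)[of "x * y"] assms y pos[OF y] by simp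
    then show "?w y - x * (?w y * y) < ?w y * exp (- x * y)"
      by (simp add: algebra_simps)
  qed (auto intro!: continuous_intros)
  ultimately show "?L < ?I"
    by (simp only: integral_unique)
  have "((\<lambda>y. ?w y - x * (?w y * y) + x\<^sup>2 / 2 * (?w y * y\<^sup>2)) has_integral ?U) {0..1}"
    using has_integral_add[OF has_integral_diff[OF m(1) has_integral_mult_right[OF m(2), of x]]
        has_integral_mult_right[OF m(3), of "x\<^sup>2 / 2"]]
    by (rule has_integral_eq_rhs) (rule alg(2))
  moreover have "?I < integral {0..1} (\<lambda>y. ?w y - x * (?w y * y) + x\<^sup>2 / 2 * (?w y * y\<^sup>2))"
  proof (rule integral_less_real)
    fix y :: real assume y: "y \<in> {0<..<1}"
    have "?w y * exp (- x * y) < ?w y * (1 - x * y + (x * y)\<^sup>2 / 2)"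
      using exp_minus_bounds(2)[of "x * y"] assms y pos[OF y] by simp
    also have "\<dots> = ?w y - x * (?w y * y) + x\<^sup>2 / 2 * (?w y * y\<^sup>2)"
      by (simp add: algebra_simps power_mult_distrib)
    finally show "?w y * exp (- x * y) < ?w y - x * (?w y * y) + x\<^sup>2 / 2 * (?w y * y\<^sup>2)" .
  qed (auto intro!: continuous_intros)
  ultimately show "?I < ?U"
    by (simp only: integral_unique)
qed

section \<open>The exact distance and its asymptotics\<close>

text \<open>The sum splits at \<open>n\<close>: up to \<open>n\<close> it is the sum of Taylor
  remainders, and beyond \<open>n\<close> only the Poisson mass is left.\<close>

lemma L1_distance_matching_poisson:
  assumes lam: "0 < lam" "lam \<le> 1"
  shows "((\<lambda>k. \<bar>pmf (map_pmf (fixed_count n) (matching_space n lam)) k - pmf (poisson_pmf lam) k\<bar>) has_sum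
    lam ^ Suc n / fact n * integral {0..1} (\<lambda>y. (y ^ n + (2 - y) ^ n) * exp (- lam * y))) UNIV"
proof -
  let ?p = "pmf (map_pmf (fixed_count n) (matching_space n lam))" and ?q = "pmf (poisson_pmf lam)"
  have q: "?q k = lam ^ k / fact k * exp (- lam)" for k
    using lam by simp
  have p: "?p k = (if k \<le> n then lam ^ k / fact k * (\<Sum>i\<le>n - k. (- lam) ^ i / fact i) else 0)" for k
    using lam by (simp add: pmf_fixed_count)
  have head: "((\<lambda>k. \<bar>?p k - ?q k\<bar>) has_sum
      lam ^ Suc n / fact n * integral {0..1} (\<lambda>y. (2 - y) ^ n * exp (- lam * y))) {..n}"
  proof (rule has_sum_finiteI)
    show "lam ^ Suc n / fact n * integral {0..1} (\<lambda>y. (2 - y) ^ n * exp (- lam * y)) = (\<Sum>k\<le>n. \<bar>?p k - ?q k\<bar>)"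
      unfolding sum_abs_exp_remainder[OF less_imp_le[OF lam(1)], symmetric]
      by (intro sum.cong) (auto simp: p q)
  qed simp
  have "(?q has_sum 1) UNIV"
    using pmf_has_sum[of "poisson_pmf lam" UNIV] by simp
  moreover have "(?q has_sum (\<Sum>k\<le>n. ?q k)) {..n}"
    by simp
  ultimately have "(?q has_sum 1 - (\<Sum>k\<le>n. ?q k)) (UNIV - {..n})"
    by (rule has_sum_Diff) simp
  moreover have "1 - (\<Sum>k\<le>n. ?q k) = exp (- lam) * (exp lam - (\<Sum>k\<le>n. lam ^ k / fact k))"
    unfolding q by (simp add: right_diff_distrib sum_distrib_left exp_minus_inverse mult.commute flip: exp_add)
  ultimately have "(?q has_sum lam ^ Suc n / fact n * integral {0..1} (\<lambda>y. y ^ n * exp (- lam * y))) (UNIV - {..n})"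
    by (simp only: poisson_tail_integral)
  then have tail: "((\<lambda>k. \<bar>?p k - ?q k\<bar>) has_sum
      lam ^ Suc n / fact n * integral {0..1} (\<lambda>y. y ^ n * exp (- lam * y))) (UNIV - {..n})"
    by (rule has_sum_cong[THEN iffD1, rotated]) (use lam in \<open>auto simp: p\<close>)
  have "integral {0..1} (\<lambda>y. (y ^ n + (2 - y) ^ n) * exp (- lam * y))
      = integral {0..1} (\<lambda>y. (2 - y) ^ n * exp (- lam * y)) + integral {0..1} (\<lambda>y. y ^ n * exp (- lam * y))"
    unfolding distrib_right
    by (subst integral_add) (auto intro!: integrable_continuous_real continuous_intros)
  then show ?thesis
    using has_sum_Un_disjoint[OF head tail] by (simp add: distrib_left Un_UNIV_right)
qed

lemma dtv_matching_poisson: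
  assumes "0 < lam" "lam \<le> 1"
  shows "dtv (measure_pmf (matching_space n lam)) (matching_Z n) (measure_pmf (poisson_pmf lam)) real
    = lam ^ (n + 1) / (2 * fact n) * integral {0..1} (\<lambda>y. (y ^ n + (2 - y) ^ n) * exp (- lam * y))"
proof -
  have "((\<lambda>k. \<bar>pmf (map_pmf (fixed_count n) (matching_space n lam)) k
        - pmf (map_pmf (\<lambda>x. x) (poisson_pmf lam)) k\<bar>) has_sum
      lam ^ Suc n / fact n * integral {0..1} (\<lambda>y. (y ^ n + (2 - y) ^ n) * exp (- lam * y))) UNIV"
    unfolding map_pmf_ident using L1_distance_matching_poisson[OF assms] .
  from dtv_of_nat[OF this] show ?thesis
    unfolding matching_Z_eq by (simp add: mult.commute)
qed

theorem theorem3p2: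
  fixes lam :: real and d :: "nat \<Rightarrow> real"
  assumes lam: "0 < lam" "lam \<le> 1"
    and d: "\<And>n. n \<ge> 1 \<Longrightarrow>
      d n = dtv (measure_pmf (matching_space n lam)) (matching_Z n) (measure_pmf (poisson_pmf lam)) real"
  shows
    "(\<forall>n\<ge>1. d n = lam ^ (n + 1) / (2 * fact n) *
        integral {0..1} (\<lambda>y::real. (y ^ n + (2 - y) ^ n) * exp (- lam * y))) \<and>
     (\<forall>n\<ge>1. d n > 2 ^ n * lam ^ (n + 1) / fact (n + 1) *
        (1 - 2 * lam / (real n + 2) * (1 - 1 / 2 ^ (n + 1)))) \<and>
     (\<forall>n\<ge>1. d n < 2 ^ n * lam ^ (n + 1) / fact (n + 1) *
        (1 - 2 * lam / (real n + 2) * (1 - 1 / 2 ^ (n + 1))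
           + 4 * lam ^ 2 / ((real n + 2) * (real n + 3)) * (1 - (real n + 3) / 2 ^ (n + 2)))) \<and>
     d \<sim>[sequentially] (\<lambda>n. 2 ^ n * lam ^ (n + 1) / fact (n + 1)) \<and>
     (\<exists>\<epsilon> \<in> o[sequentially](\<lambda>n. 1 / real n). \<forall>n\<ge>1.
        d n = 2 ^ n * lam ^ (n + 1) / fact (n + 1) * (1 - 2 * lam / (real n + 2) + \<epsilon> n))"
proof -
  define c where "c n = 2 ^ n * lam ^ (n + 1) / fact (n + 1)" for n :: nat
  define I where "I n = integral {0..1} (\<lambda>y::real. (y ^ n + (2 - y) ^ n) * exp (- lam * y))" for n
  define L where "L n = 1 - 2 * lam / (real n + 2) * (1 - 1 / 2 ^ (n + 1))" for n
  define R where "R n = 4 * lam ^ 2 / ((real n + 2) * (real n + 3)) * (1 - (real n + 3) / 2 ^ (n + 2))" for n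
  have c_pos: "0 < c n" for n
    using lam by (simp add: c_def)
  have formula: "d n = lam ^ (n + 1) / (2 * fact n) * I n" if "n \<ge> 1" for n
    using d[OF that] dtv_matching_poisson[OF lam] by (simp add: I_def)
  \<comment> \<open>The bounds for the integral carry the factor
    \<open>2 ^ Suc n / (real n + 1)\<close>; together with the prefactor of the exact formula it
    makes up \<open>c n\<close>.\<close>
  have scale: "c n * x = lam ^ (n + 1) / (2 * fact n) * (2 ^ Suc n / (real n + 1) * x)" for n x
    by (simp add: c_def field_simps)
  have lower: "c n * L n < d n" and upper: "d n < c n * (L n + R n)" if "n \<ge> 1" for n
  proof -
    have "0 < lam ^ (n + 1) / (2 * fact n)"
      using lam by simp
    note mono = mult_strict_left_mono[OF _ this]
    show "c n * L n < d n"
      unfolding formula[OF that] scale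
      by (rule mono) (use integral_power_exp_lower[OF lam(1), of n] in \<open>simp add: L_def I_def\<close>)
    show "d n < c n * (L n + R n)"
      unfolding formula[OF that] scale
      by (rule mono) (use integral_power_exp_upper[OF lam(1), of n] in \<open>simp add: L_def R_def I_def\<close>)
  qed
  \<comment> \<open>The expansion is solved for its error term. It then holds for every
    \<open>n\<close>, while the estimate on \<open>\<epsilon>\<close> is restricted to
    \<open>n \<ge> 1\<close>, since \<open>d 0\<close> is arbitrary.\<close>
  define \<epsilon> where "\<epsilon> n = d n / c n - (1 - 2 * lam / (real n + 2))" for n
  have expansion: "d n = c n * (1 - 2 * lam / (real n + 2) + \<epsilon> n)" for n
    using c_pos[of n] by (simp add: \<epsilon>_def)
  \<comment> \<open>\<open>L n\<close> differs from the first-order term by an exponentially small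
    amount, and \<open>R n\<close> has order \<open>1 / n^2\<close>, so both parts are
    \<open>o(1 / n)\<close>.\<close>
  have "\<bar>\<epsilon> n\<bar> \<le> 2 * lam / (real n + 2) / 2 ^ (n + 1) + \<bar>R n\<bar>" if "n \<ge> 1" for n
  proof -
    have "L n < d n / c n" "d n / c n < L n + R n"
      using lower[OF that] upper[OF that] c_pos[of n] by (simp_all add: field_simps)
    moreover have "L n = 1 - 2 * lam / (real n + 2) + 2 * lam / (real n + 2) / 2 ^ (n + 1)"
    proof -
      have "1 - a * (1 - 1 / b) = 1 - a + a / b" for a b :: real
        by (simp add: right_diff_distrib)
      then show ?thesis
        unfolding L_def .
    qed
    moreover have "0 \<le> 2 * lam / (real n + 2) / 2 ^ (n + 1)"
      using lam by simp
    ultimately show ?thesis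
      unfolding \<epsilon>_def by linarith
  qed
  then have "\<epsilon> \<in> O(\<lambda>n. 2 * lam / (real n + 2) / 2 ^ (n + 1) + \<bar>R n\<bar>)"
    by (intro landau_o.big_mono eventually_sequentiallyI[of 1])
      (simp only: real_norm_def, rule order.trans[OF _ abs_ge_self])
  also have "(\<lambda>n. 2 * lam / (real n + 2) / 2 ^ (n + 1) + \<bar>R n\<bar>) \<in> o(\<lambda>n. 1 / real n)"
  proof (rule sum_in_smallo)
    show "(\<lambda>n. 2 * lam / (real n + 2) / 2 ^ (n + 1)) \<in> o(\<lambda>n. 1 / real n)"
      by real_asymp
    have "R \<in> o(\<lambda>n. 1 / real n)"
      unfolding R_def by real_asymp
    then show "(\<lambda>n. \<bar>R n\<bar>) \<in> o(\<lambda>n. 1 / real n)"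
      by simp
  qed
  finally have small: "\<epsilon> \<in> o(\<lambda>n. 1 / real n)" .
  \<comment> \<open>By the expansion this sequence is \<open>d n / c n\<close>, so its limit
    \<open>1\<close> is the asymptotic equivalence.\<close>
  have "(\<lambda>n. 1 - 2 * lam / (real n + 2) + \<epsilon> n) \<longlonglongrightarrow> 1 - 0 + 0"
  proof (intro tendsto_intros)
    show "(\<lambda>n. 2 * lam / (real n + 2)) \<longlonglongrightarrow> 0"
      by real_asymp
    have "(\<lambda>n. 1 / real n) \<in> O(\<lambda>_. 1)"
      by real_asymp
    with small have "\<epsilon> \<in> o(\<lambda>_. 1)"
      by (rule landau_o.small_big_trans)
    then show "\<epsilon> \<longlonglongrightarrow> 0"
      by (rule smalloD_tendsto[of _ _ "\<lambda>_. 1", simplified])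
  qed
  then have "d \<sim>[sequentially] c"
    using c_pos by (intro asymp_equivI') (simp add: expansion less_imp_neq[OF c_pos, symmetric])
  then show ?thesis
    using formula lower upper expansion small unfolding c_def I_def L_def R_def by blast
qed

end
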